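(* Let $\sigma(x_1,\dots,x_k)$ be a bounded-quantifier formula of set theory and let $\xi_1,\dots,\xi_k\in\mathbb V_1$ be internal elements. Then $\sigma(\xi_1,\dots,\xi_k)\iff\sigma({}^\circledast\xi_1,\dots,{}^\circledast\xi_k)$.
   Context: Let $\mathbf X$ be a set of atoms with $\mathbb R\subseteq\mathbf X$, and $\mathbb V=\bigcup_{k\ge0}V_k(\mathbf X)$ the superstructure over $\mathbf X$ ($V_0(\mathbf X)=\mathbf X$, $V_{k+1}(\mathbf X)=V_k(\mathbf X)\cup\mathcal P(V_k(\mathbf X))$). Fix a star map $*:\mathbb V\to\mathbb V$, also written $\mathfrak s$ (${}^*A=\mathfrak s(A)$), such that ${}^*\mathbf X=\mathbf X$, ${}^*r=r$ for all $r\in\mathbb R$, ${}^*\mathbb N\ne\mathbb N$, and transfer holds: for every bounded-quantifier formula $\varphi$ and all $A_i\in\mathbb V$, $\varphi(A_1,\dots,A_k)\iff\varphi({}^*A_1,\dots,{}^*A_k)$. The internal universe is $\mathbb V_1=\bigcup_{X\in\mathbb V}{}^*X$. For $X\in\mathbb V$ the restriction $\mathfrak s\upharpoonright X$ is an element of $\mathbb V$; the internal star map $\circledast:\mathbb V_1\to\mathbb V$ is $\circledast=\bigcup_{X\in\mathbb V}{}^*(\mathfrak s\upharpoonright X)$ (a well-defined function), written ${}^\circledast\xi=\circledast(\xi)$. *)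

theory Defs
  imports Complex_Main
begin

text \<open>
  The superstructure over a set of atoms is a cumulative hierarchy with \<open>\<omega>\<close> levels, which HOL cannot
  construct as a type. It is therefore given as a structure on a type \<open>'v\<close>: a set \<open>X\<close> of atoms
  and a membership relation \<open>E\<close>, where \<open>E y v\<close> means that \<open>y\<close> is an element of \<open>v\<close>. The locale
  \<open>superstructure\<close> below determines the part of \<open>'v\<close> lying in \<open>universe X E\<close> up to isomorphism
  over \<open>X\<close>; elements of \<open>'v\<close> outside of \<open>universe X E\<close> are irrelevant.
\<close>

definition elems :: "('v \<Rightarrow> 'v \<Rightarrow> bool) \<Rightarrow> 'v \<Rightarrow> 'v set" where
  "elems E v = {y. E y v}"

primrec level :: "'v set \<Rightarrow> ('v \<Rightarrow> 'v \<Rightarrow> bool) \<Rightarrow> nat \<Rightarrow> 'v set" where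
  "level X E 0 = X"
| "level X E (Suc k) = level X E k \<union> {v. v \<notin> X \<and> elems E v \<subseteq> level X E k}"

definition universe :: "'v set \<Rightarrow> ('v \<Rightarrow> 'v \<Rightarrow> bool) \<Rightarrow> 'v set" where
  "universe X E = (\<Union>k. level X E k)"

text \<open>
  \<open>coll X E A\<close> is the set of the superstructure whose elements are exactly those of \<open>A\<close>. It is
  meaningful only if \<open>A\<close> is contained in some level.
\<close>

definition coll :: "'v set \<Rightarrow> ('v \<Rightarrow> 'v \<Rightarrow> bool) \<Rightarrow> 'v set \<Rightarrow> 'v" where
  "coll X E A = (THE v. v \<in> universe X E \<and> v \<notin> X \<and> elems E v = A)"

text \<open>Kuratowski pairs.\<close>

definition opair :: "'v set \<Rightarrow> ('v \<Rightarrow> 'v \<Rightarrow> bool) \<Rightarrow> 'v \<Rightarrow> 'v \<Rightarrow> 'v" where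
  "opair X E a b = coll X E {coll X E {a}, coll X E {a, b}}"

text \<open>
  The inclusion of the reals into the atoms is rendered by an injection \<open>rl\<close>.
\<close>

locale superstructure =
  fixes X :: "'v set"
    and E :: "'v \<Rightarrow> 'v \<Rightarrow> bool"
    and rl :: "real \<Rightarrow> 'v"
  assumes atom_no_elems: "x \<in> X \<Longrightarrow> elems E x = {}"
    and extensional:
      "\<lbrakk>v \<in> universe X E - X; w \<in> universe X E - X; elems E v = elems E w\<rbrakk> \<Longrightarrow> v = w"
    and full_powerset: "A \<subseteq> level X E k \<Longrightarrow> \<exists>v. v \<notin> X \<and> elems E v = A"
    and rl_inj: "inj rl"
    and rl_atoms: "range rl \<subseteq> X"

text \<open>
  Bounded-quantifier formulas in the language of \<open>\<in>\<close> and \<open>=\<close>, with variables numbered by naturals.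
  The bound \<open>y\<close> in \<open>BAll x y \<phi>\<close> (read: for all \<open>x \<in> y\<close>, \<open>\<phi>\<close>) is evaluated outside of the scope
  of \<open>x\<close>.
\<close>

datatype bformula =
    Mem nat nat
  | Eq nat nat
  | Neg bformula
  | And bformula bformula
  | Or bformula bformula
  | Imp bformula bformula
  | BAll nat nat bformula
  | BEx nat nat bformula

primrec fv :: "bformula \<Rightarrow> nat set" where
  "fv (Mem i j) = {i, j}"
| "fv (Eq i j) = {i, j}"
| "fv (Neg \<phi>) = fv \<phi>"
| "fv (And \<phi> \<psi>) = fv \<phi> \<union> fv \<psi>"
| "fv (Or \<phi> \<psi>) = fv \<phi> \<union> fv \<psi>"
| "fv (Imp \<phi> \<psi>) = fv \<phi> \<union> fv \<psi>"
| "fv (BAll x y \<phi>) = insert y (fv \<phi> - {x})"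
| "fv (BEx x y \<phi>) = insert y (fv \<phi> - {x})"

primrec sat :: "('v \<Rightarrow> 'v \<Rightarrow> bool) \<Rightarrow> bformula \<Rightarrow> (nat \<Rightarrow> 'v) \<Rightarrow> bool" where
  "sat E (Mem i j) e \<longleftrightarrow> E (e i) (e j)"
| "sat E (Eq i j) e \<longleftrightarrow> e i = e j"
| "sat E (Neg \<phi>) e \<longleftrightarrow> \<not> sat E \<phi> e"
| "sat E (And \<phi> \<psi>) e \<longleftrightarrow> sat E \<phi> e \<and> sat E \<psi> e"
| "sat E (Or \<phi> \<psi>) e \<longleftrightarrow> sat E \<phi> e \<or> sat E \<psi> e"
| "sat E (Imp \<phi> \<psi>) e \<longleftrightarrow> (sat E \<phi> e \<longrightarrow> sat E \<psi> e)"
| "sat E (BAll x y \<phi>) e \<longleftrightarrow> (\<forall>a. E a (e y) \<longrightarrow> sat E \<phi> (e(x := a)))"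
| "sat E (BEx x y \<phi>) e \<longleftrightarrow> (\<exists>a. E a (e y) \<and> sat E \<phi> (e(x := a)))"

locale star_map = superstructure X E rl
  for X :: "'v set"
    and E :: "'v \<Rightarrow> 'v \<Rightarrow> bool"
    and rl :: "real \<Rightarrow> 'v" +
  fixes star :: "'v \<Rightarrow> 'v"
  assumes star_universe: "A \<in> universe X E \<Longrightarrow> star A \<in> universe X E"
    and star_atoms: "star (coll X E X) = coll X E X"
    and star_real: "star (rl r) = rl r"
    and star_Nats: "star (coll X E (rl ` \<nat>)) \<noteq> coll X E (rl ` \<nat>)"
    and transfer:
      "\<lbrakk>fv \<phi> \<subseteq> {1..k}; \<forall>i\<in>{1..k}. e i \<in> universe X E\<rbrakk>
        \<Longrightarrow> sat E \<phi> e \<longleftrightarrow> sat E \<phi> (\<lambda>i. star (e i))"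

definition internal :: "'v set \<Rightarrow> ('v \<Rightarrow> 'v \<Rightarrow> bool) \<Rightarrow> ('v \<Rightarrow> 'v) \<Rightarrow> 'v set" where
  "internal X E star = (\<Union>A\<in>universe X E. elems E (star A))"

text \<open>The restriction of the star map to \<open>A\<close>, as an element of the superstructure.\<close>

definition star_restrict :: "'v set \<Rightarrow> ('v \<Rightarrow> 'v \<Rightarrow> bool) \<Rightarrow> ('v \<Rightarrow> 'v) \<Rightarrow> 'v \<Rightarrow> 'v" where
  "star_restrict X E star A = coll X E ((\<lambda>a. opair X E a (star a)) ` elems E A)"

text \<open>
  The graph of the internal star map. The restriction of \<open>\<xi>\<close> and \<open>\<eta>\<close> to the superstructure only
  discards arguments for which \<open>opair\<close> is meaningless.
\<close>

definition istar_graph :: "'v set \<Rightarrow> ('v \<Rightarrow> 'v \<Rightarrow> bool) \<Rightarrow> ('v \<Rightarrow> 'v) \<Rightarrow> ('v \<times> 'v) set" where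
  "istar_graph X E star =
    (\<Union>A\<in>universe X E. {(\<xi>, \<eta>). \<xi> \<in> universe X E \<and> \<eta> \<in> universe X E \<and>
      opair X E \<xi> \<eta> \<in> elems E (star (star_restrict X E star A))})"

definition istar :: "'v set \<Rightarrow> ('v \<Rightarrow> 'v \<Rightarrow> bool) \<Rightarrow> ('v \<Rightarrow> 'v) \<Rightarrow> 'v \<Rightarrow> 'v" where
  "istar X E star \<xi> = (THE \<eta>. (\<xi>, \<eta>) \<in> istar_graph X E star)"

end

theory Submission
  imports Defs
begin

text \<open>
  Every internal \<open>\<xi>\<^sub>i\<close> lies in \<open>\<^sup>*A\<close> for one sufficiently high level \<open>A\<close>. With \<open>F\<close> the restriction
  of the star map to \<open>A\<close>, transfer of \<open>\<sigma>\<close> says that \<open>\<sigma>(x) \<longleftrightarrow> \<sigma>(y)\<close> whenever all pairs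
  \<open>(x\<^sub>i, y\<^sub>i)\<close> belong to \<open>F\<close>. This is itself a bounded statement about the parameter \<open>F\<close>, so it can
  be transferred once more, to \<open>\<^sup>*F\<close>. The instance \<open>x\<^sub>1 = x\<^sub>2\<close> of \<open>\<sigma>\<close> shows that the internal star
  map is well defined.
\<close>

section \<open>Bounded formulas\<close>

lemma finite_fv: "finite (fv \<phi>)"
  by (induction \<phi>) auto

lemma sat_cong: "(\<And>i. i \<in> fv \<phi> \<Longrightarrow> e i = e' i) \<Longrightarrow> sat E \<phi> e \<longleftrightarrow> sat E \<phi> e'"
proof (induction \<phi> arbitrary: e e')
  case (BAll x y \<phi>)
  have "sat E \<phi> (e(x := a)) \<longleftrightarrow> sat E \<phi> (e'(x := a))" for a
    by (rule BAll.IH) (use BAll.prems in auto)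
  then show ?case using BAll.prems by simp
next
  case (BEx x y \<phi>)
  have "sat E \<phi> (e(x := a)) \<longleftrightarrow> sat E \<phi> (e'(x := a))" for a
    by (rule BEx.IH) (use BEx.prems in auto)
  then show ?case using BEx.prems by simp
next
  case (And \<phi> \<psi>)
  then show ?case by (metis UnCI fv.simps(4) sat.simps(4))
next
  case (Or \<phi> \<psi>)
  then show ?case by (metis UnCI fv.simps(5) sat.simps(5))
next
  case (Imp \<phi> \<psi>)
  then show ?case by (metis UnCI fv.simps(6) sat.simps(6))
next
  case (Neg \<phi>)
  then show ?case by (metis fv.simps(3) sat.simps(3))
qed auto

text \<open>Bound variables are renamed too, so that injectivity of the renaming rules out capture.\<close>

primrec rename :: "(nat \<Rightarrow> nat) \<Rightarrow> bformula \<Rightarrow> bformula" where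
  "rename r (Mem i j) = Mem (r i) (r j)"
| "rename r (Eq i j) = Eq (r i) (r j)"
| "rename r (Neg \<phi>) = Neg (rename r \<phi>)"
| "rename r (And \<phi> \<psi>) = And (rename r \<phi>) (rename r \<psi>)"
| "rename r (Or \<phi> \<psi>) = Or (rename r \<phi>) (rename r \<psi>)"
| "rename r (Imp \<phi> \<psi>) = Imp (rename r \<phi>) (rename r \<psi>)"
| "rename r (BAll x y \<phi>) = BAll (r x) (r y) (rename r \<phi>)"
| "rename r (BEx x y \<phi>) = BEx (r x) (r y) (rename r \<phi>)"

lemma fv_rename: "inj r \<Longrightarrow> fv (rename r \<phi>) = r ` fv \<phi>"
  by (induction \<phi>) (auto dest: injD)

lemma sat_rename:
  assumes "inj r"
  shows "sat E (rename r \<phi>) e \<longleftrightarrow> sat E \<phi> (\<lambda>i. e (r i))"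
proof -
  \<comment> \<open>Since \<open>r\<close> is injective, an update at \<open>r x\<close> changes
    only index \<open>x\<close> after composition with \<open>r\<close>.\<close>
  have upd: "(\<lambda>i. if r i = r x then a else e (r i)) = (\<lambda>i. e (r i))(x := a)" for e :: "nat \<Rightarrow> 'a" and x a
    using assms by (auto simp: fun_eq_iff dest: injD)
  show ?thesis
    by (induction \<phi> arbitrary: e) (simp_all add: upd)
qed

section \<open>Pairs\<close>

text \<open>Relational form of the Kuratowski pair: it mentions only membership, so a bounded
  formula can express it.\<close>

definition is_pair :: "('v \<Rightarrow> 'v \<Rightarrow> bool) \<Rightarrow> 'v \<Rightarrow> 'v \<Rightarrow> 'v \<Rightarrow> bool" where
  "is_pair E z x y \<longleftrightarrow> (\<exists>u v. elems E z = {u, v} \<and> elems E u = {x} \<and> elems E v = {x, y})"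

lemma is_pair_inject:
  assumes "is_pair E z x y" "is_pair E z x' y'"
  shows "x = x' \<and> y = y'"
proof -
  obtain u v u' v' where "elems E z = {u, v}" "elems E u = {x}" "elems E v = {x, y}"
    "elems E z = {u', v'}" "elems E u' = {x'}" "elems E v' = {x', y'}"
    using assms unfolding is_pair_def by blast
  \<comment> \<open>Both sides are the family of all \<open>elems E w\<close> with \<open>w\<close>
    in \<open>elems E z\<close>, which depends only on \<open>z\<close>.\<close>
  then have "{{x}, {x, y}} = {{x'}, {x', y'}}"
    by (metis image_empty image_insert)
  then show ?thesis
    by (auto simp: doubleton_eq_iff)
qed

text \<open>Supplies the element of the pair that bounds the quantifiers over both
  components.\<close>

lemma is_pair_imp_elem: "is_pair E z x y \<Longrightarrow> \<exists>v. E v z \<and> E x v \<and> E y v"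
  unfolding is_pair_def elems_def by blast

text \<open>Binds the variables 1, 2 and 3, hence must not be used with these as arguments.\<close>

definition pair_formula :: "nat \<Rightarrow> nat \<Rightarrow> nat \<Rightarrow> bformula" where
  "pair_formula z x y = BEx 1 z (BEx 2 z
    (And (BAll 3 z (Or (Eq 3 1) (Eq 3 2)))
    (And (And (Mem x 1) (BAll 3 1 (Eq 3 x)))
      (And (And (Mem x 2) (Mem y 2)) (BAll 3 2 (Or (Eq 3 x) (Eq 3 y)))))))"

lemma fv_pair_formula: "fv (pair_formula z x y) \<subseteq> {z, x, y}"
  by (auto simp: pair_formula_def)

lemma sat_pair_formula:
  assumes "{z, x, y} \<inter> {1, 2, 3} = {}"
  shows "sat E (pair_formula z x y) e \<longleftrightarrow> is_pair E (e z) (e x) (e y)"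
proof -
  have "sat E (pair_formula z x y) e \<longleftrightarrow>
    (\<exists>u. E u (e z) \<and> (\<exists>v. E v (e z) \<and> (\<forall>w. E w (e z) \<longrightarrow> w = u \<or> w = v) \<and>
      (E (e x) u \<and> (\<forall>w. E w u \<longrightarrow> w = e x)) \<and>
      (E (e x) v \<and> E (e y) v) \<and> (\<forall>w. E w v \<longrightarrow> w = e x \<or> w = e y)))"
    using assms by (simp add: pair_formula_def)
  also have "\<dots> \<longleftrightarrow> is_pair E (e z) (e x) (e y)"
    unfolding is_pair_def elems_def set_eq_iff by (simp, blast)
  finally show ?thesis .
qed

text \<open>
  \<open>pairs_formula \<sigma> k\<close> says that \<open>\<sigma>(x) \<longleftrightarrow> \<sigma>(y)\<close> for all pairs \<open>(x\<^sub>i, y\<^sub>i)\<close>, \<open>1 \<le> i \<le> k\<close>, in the value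
  of variable 0. The variables for \<open>x\<^sub>i\<close> and \<open>y\<^sub>i\<close> are \<open>2 i + 8\<close> and \<open>2 i + 9\<close>. Each pair is variable 4, and both
  components are bounded by an element of it, variable 2.
\<close>

primrec pairs_formula :: "bformula \<Rightarrow> nat \<Rightarrow> bformula" where
  "pairs_formula \<sigma> 0 = And (Imp (rename (\<lambda>i. 2 * i + 8) \<sigma>) (rename (\<lambda>i. 2 * i + 9) \<sigma>))
     (Imp (rename (\<lambda>i. 2 * i + 9) \<sigma>) (rename (\<lambda>i. 2 * i + 8) \<sigma>))"
| "pairs_formula \<sigma> (Suc n) = BAll 4 0 (BAll 2 4 (BAll (2 * Suc n + 8) 2 (BAll (2 * Suc n + 9) 2
     (Imp (pair_formula 4 (2 * Suc n + 8) (2 * Suc n + 9)) (pairs_formula \<sigma> n)))))"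

lemma inj_pair_vars: "inj (\<lambda>i::nat. 2 * i + 8)" "inj (\<lambda>i::nat. 2 * i + 9)"
  by (auto simp: inj_def)

lemma sat_pairs_formula_0:
  "sat E (pairs_formula \<sigma> 0) e \<longleftrightarrow>
    (sat E \<sigma> (\<lambda>i. e (2 * i + 8)) \<longleftrightarrow> sat E \<sigma> (\<lambda>i. e (2 * i + 9)))"
  by (auto simp: sat_rename inj_pair_vars)

text \<open>The component variables are at least 10, one even and one odd, so they clash neither
  with each other nor with the auxiliary variables 0 to 4.\<close>

lemma sat_pairs_formula_Suc:
  "sat E (pairs_formula \<sigma> (Suc n)) e \<longleftrightarrow>
    (\<forall>p v x y. E p (e 0) \<longrightarrow> E v p \<longrightarrow> E x v \<longrightarrow> E y v \<longrightarrow> is_pair E p x y \<longrightarrow>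
      sat E (pairs_formula \<sigma> n) (e(4 := p, 2 := v, 2 * Suc n + 8 := x, 2 * Suc n + 9 := y)))"
  by (auto simp: sat_pair_formula)

text \<open>Pair \<open>k\<close> is quantified outermost: at stage \<open>n\<close> the pairs with
  index above \<open>n\<close> are still free, and at \<open>n = k\<close> only the parameter 0
  is.\<close>

lemma fv_pairs_formula:
  assumes "fv \<sigma> \<subseteq> {1..k}" "n \<le> k"
  shows "fv (pairs_formula \<sigma> n) \<subseteq> {0} \<union> (\<lambda>i. 2 * i + 8) ` {n<..k} \<union> (\<lambda>i. 2 * i + 9) ` {n<..k}"
  using \<open>n \<le> k\<close>
proof (induction n)
  case 0
  then show ?case using assms(1) by (auto simp: fv_rename inj_pair_vars)
next
  case (Suc n)
  then have "{n<..k} = insert (Suc n) {Suc n<..k}" by auto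
  with Suc show ?case using fv_pair_formula[of 4 "2 * Suc n + 8" "2 * Suc n + 9"] by auto
qed

lemma pairs_formula_elim:
  assumes "sat E (pairs_formula \<sigma> n) e" "\<And>i. i \<in> {1..n} \<Longrightarrow> \<exists>p. E p (e 0) \<and>
    is_pair E p (e (2 * i + 8)) (e (2 * i + 9))"
  shows "sat E \<sigma> (\<lambda>i. e (2 * i + 8)) \<longleftrightarrow> sat E \<sigma> (\<lambda>i. e (2 * i + 9))"
  using assms
proof (induction n arbitrary: e)
  case 0
  then show ?case by (simp only: sat_pairs_formula_0)
next
  case (Suc n)
  obtain p where p: "E p (e 0)" "is_pair E p (e (2 * Suc n + 8)) (e (2 * Suc n + 9))"
    using Suc.prems(2)[of "Suc n"] by auto
  obtain v where v: "E v p" "E (e (2 * Suc n + 8)) v" "E (e (2 * Suc n + 9)) v"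
    using is_pair_imp_elem[OF p(2)] by auto
  \<comment> \<open>Each component quantifier is instantiated with the value that \<open>e\<close>
    already has, so only the auxiliary variables 4 and 2 change.\<close>
  define e' where "e' = e(4 := p, 2 := v)"
  have "e(4 := p, 2 := v, 2 * Suc n + 8 := e (2 * Suc n + 8), 2 * Suc n + 9 := e (2 * Suc n + 9)) = e'"
    by (auto simp: e'_def fun_eq_iff)
  then have "sat E (pairs_formula \<sigma> n) e'"
    using Suc.prems(1) p v unfolding sat_pairs_formula_Suc by metis
  moreover have "e' 0 = e 0" "e' (2 * i + 8) = e (2 * i + 8)" "e' (2 * i + 9) = e (2 * i + 9)" for i
    by (auto simp: e'_def)
  ultimately show ?case using Suc.IH[of e'] Suc.prems(2) by simp
qed

section \<open>Superstructures\<close>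

context superstructure
begin

lemma level_mono: "m \<le> n \<Longrightarrow> level X E m \<subseteq> level X E n"
  by (rule lift_Suc_mono_le) auto

lemma elems_subset_level: "v \<in> level X E k \<Longrightarrow> elems E v \<subseteq> level X E k"
  by (induction k) (auto dest: atom_no_elems)

lemma level_subset_universe: "level X E k \<subseteq> universe X E"
  unfolding universe_def by blast

lemma elem_universe: "v \<in> universe X E \<Longrightarrow> E y v \<Longrightarrow> y \<in> universe X E"
  using elems_subset_level unfolding universe_def elems_def by blast

text \<open>Full power sets give existence and extensionality gives uniqueness, so the description
  in \<open>coll\<close> is proper.\<close>

lemma coll:
  assumes "A \<subseteq> level X E k"
  shows "coll X E A \<in> level X E (Suc k)" "coll X E A \<notin> X" "elems E (coll X E A) = A"
proof -
  obtain v where v: "v \<notin> X" "elems E v = A"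
    using full_powerset[OF assms] by blast
  then have lev: "v \<in> level X E (Suc k)"
    using assms by simp
  then have univ: "v \<in> universe X E"
    using level_subset_universe by blast
  have "coll X E A = v"
    unfolding coll_def by (rule the_equality) (use v univ extensional in auto)
  then show "coll X E A \<in> level X E (Suc k)" "coll X E A \<notin> X" "elems E (coll X E A) = A"
    using v lev by auto
qed

lemma coll_universe: "A \<subseteq> level X E k \<Longrightarrow> coll X E A \<in> universe X E"
  using coll(1) level_subset_universe by blast

text \<open>A nonempty extension excludes atoms, to which extensionality does not apply.\<close>

lemma coll_eqI:
  assumes "v \<in> universe X E" "elems E v = A" "A \<noteq> {}"
  shows "v = coll X E A"
proof -
  obtain k where k: "A \<subseteq> level X E k"
    using assms(1,2) elems_subset_level unfolding universe_def by blast
  have "v \<notin> X" using atom_no_elems assms by blast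
  then show ?thesis
    using extensional coll[OF k] coll_universe[OF k] assms by simp
qed

section \<open>Kuratowski pairs inside the superstructure\<close>

lemma is_pair_opair_level:
  assumes "a \<in> level X E k" "b \<in> level X E k"
  shows "is_pair E (opair X E a b) a b" "opair X E a b \<in> level X E (Suc (Suc k))"
proof -
  have 1: "coll X E {a} \<in> level X E (Suc k)" "elems E (coll X E {a}) = {a}"
    using coll[of "{a}" k] assms by auto
  have 2: "coll X E {a, b} \<in> level X E (Suc k)" "elems E (coll X E {a, b}) = {a, b}"
    using coll[of "{a, b}" k] assms by auto
  have 3: "{coll X E {a}, coll X E {a, b}} \<subseteq> level X E (Suc k)"
    using 1 2 by blast
  show "is_pair E (opair X E a b) a b"
    using 1 2 coll(3)[OF 3] unfolding is_pair_def opair_def by blast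
  show "opair X E a b \<in> level X E (Suc (Suc k))"
    using coll(1)[OF 3] unfolding opair_def .
qed

lemma obtain_level:
  assumes "a \<in> universe X E" "b \<in> universe X E"
  obtains k where "a \<in> level X E k" "b \<in> level X E k"
proof -
  obtain i j where "a \<in> level X E i" "b \<in> level X E j"
    using assms unfolding universe_def by blast
  then show ?thesis
    using that[of "max i j"] level_mono[of i "max i j"] level_mono[of j "max i j"] by auto
qed

lemma is_pair_opair:
  assumes "a \<in> universe X E" "b \<in> universe X E"
  shows "is_pair E (opair X E a b) a b"
  using obtain_level[OF assms] is_pair_opair_level(1) by metis

text \<open>All sets involved are nonempty, so \<open>coll_eqI\<close> identifies a relational pair
  with \<open>opair\<close>.\<close>

lemma is_pair_universe:
  assumes "z \<in> universe X E" "is_pair E z a b"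
  shows "a \<in> universe X E" "b \<in> universe X E" "z = opair X E a b"
proof -
  obtain u v where uv: "elems E z = {u, v}" "elems E u = {a}" "elems E v = {a, b}"
    using assms(2) unfolding is_pair_def by blast
  then have "E u z" "E v z" "E a v" "E b v"
    unfolding elems_def by auto
  then have univ: "u \<in> universe X E" "v \<in> universe X E" "a \<in> universe X E" "b \<in> universe X E"
    using assms(1) elem_universe by blast+
  then show "a \<in> universe X E" "b \<in> universe X E" by auto
  have "u = coll X E {a}" "v = coll X E {a, b}"
    using univ uv coll_eqI by auto
  then show "z = opair X E a b"
    using coll_eqI[OF assms(1) uv(1)] unfolding opair_def by simp
qed

lemma universe_level_set:
  shows "coll X E (level X E m) \<in> universe X E" "elems E (coll X E (level X E m)) = level X E m"
  by (rule coll_universe coll(3), rule order_refl)+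

end

section \<open>The internal star map\<close>

context star_map
begin

text \<open>Frees \<open>transfer\<close> from its numbering convention: renaming by
  \<open>Suc\<close> moves variable 0, used below for a parameter, into the range from 1.\<close>

lemma transfer_fv:
  assumes "\<And>i. i \<in> fv \<phi> \<Longrightarrow> e i \<in> universe X E"
  shows "sat E \<phi> e \<longleftrightarrow> sat E \<phi> (\<lambda>i. star (e i))"
proof -
  \<comment> \<open>The default \<open>rl 0\<close> keeps the other variables in the universe, as
    \<open>transfer\<close> asks this for all of \<open>{1..k}\<close>.\<close>
  define e' where "e' i = (if i \<in> fv \<phi> then e i else rl 0)" for i
  have "rl 0 \<in> universe X E"
    using rl_atoms level_subset_universe[of 0] by auto
  then have univ: "e' i \<in> universe X E" for i
    using assms by (simp add: e'_def)
  obtain k where "\<forall>i\<in>fv \<phi>. i < k"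
    using finite_nat_set_iff_bounded finite_fv by blast
  then have "fv (rename Suc \<phi>) \<subseteq> {1..k}"
    by (auto simp: fv_rename)
  then have "sat E (rename Suc \<phi>) (\<lambda>i. e' (i - 1)) \<longleftrightarrow> sat E (rename Suc \<phi>) (\<lambda>i. star (e' (i - 1)))"
    using transfer[of "rename Suc \<phi>" k "\<lambda>i. e' (i - 1)"] univ by blast
  then have "sat E \<phi> e' \<longleftrightarrow> sat E \<phi> (\<lambda>i. star (e' i))"
    by (simp add: sat_rename)
  moreover have "sat E \<phi> e' \<longleftrightarrow> sat E \<phi> e"
    by (rule sat_cong) (simp add: e'_def)
  moreover have "sat E \<phi> (\<lambda>i. star (e' i)) \<longleftrightarrow> sat E \<phi> (\<lambda>i. star (e i))"
    by (rule sat_cong) (simp add: e'_def)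
  ultimately show ?thesis by simp
qed

section \<open>First consequences of transfer\<close>

lemma star_mem:
  assumes "A \<in> universe X E" "E a A"
  shows "E (star a) (star A)"
  using transfer_fv[of "Mem 0 1" "\<lambda>i. if i = 0 then a else A"] assms elem_universe by auto

lemma star_mono:
  assumes "A \<in> universe X E" "B \<in> universe X E" "elems E A \<subseteq> elems E B"
  shows "elems E (star A) \<subseteq> elems E (star B)"
proof -
  let ?e = "\<lambda>i::nat. if i = 0 then A else B"
  have "sat E (BAll 2 0 (Mem 2 1)) ?e \<longleftrightarrow> sat E (BAll 2 0 (Mem 2 1)) (\<lambda>i. star (?e i))"
    by (rule transfer_fv) (use assms in simp)
  then show ?thesis
    using assms(3) by (auto simp: elems_def)
qed

text \<open>If \<open>A\<close> and \<open>star A\<close> lie in level \<open>k\<close>, so do all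
  \<open>a\<close> and \<open>star a\<close>; hence the pairs lie in one common level and can be
  collected.\<close>

lemma star_restrict:
  assumes "A \<in> universe X E"
  shows "star_restrict X E star A \<in> universe X E"
    and "elems E (star_restrict X E star A) = (\<lambda>a. opair X E a (star a)) ` elems E A"
proof -
  obtain k where k: "A \<in> level X E k" "star A \<in> level X E k"
    using obtain_level assms star_universe by metis
  have "(\<lambda>a. opair X E a (star a)) ` elems E A \<subseteq> level X E (Suc (Suc k))"
  proof (rule image_subsetI)
    fix a assume "a \<in> elems E A"
    then have "a \<in> level X E k" "star a \<in> level X E k"
      using k elems_subset_level star_mem[OF assms] unfolding elems_def by blast+
    then show "opair X E a (star a) \<in> level X E (Suc (Suc k))"
      by (rule is_pair_opair_level)
  qed
  from coll_universe[OF this] coll(3)[OF this]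
  show "star_restrict X E star A \<in> universe X E"
    "elems E (star_restrict X E star A) = (\<lambda>a. opair X E a (star a)) ` elems E A"
    unfolding star_restrict_def by auto
qed

lemma star_restrict_pair:
  assumes "A \<in> universe X E" "E p (star_restrict X E star A)" "is_pair E p x y"
  shows "E x A" "y = star x"
proof -
  have "p \<in> (\<lambda>a. opair X E a (star a)) ` elems E A"
    using assms(2) star_restrict(2)[OF assms(1)] unfolding elems_def by blast
  then obtain a where a: "E a A" "p = opair X E a (star a)"
    unfolding elems_def by blast
  then have "is_pair E p a (star a)"
    using is_pair_opair elem_universe[OF assms(1)] star_universe by simp
  then have "x = a \<and> y = star a"
    using is_pair_inject[OF assms(3)] by blast
  then show "E x A" "y = star x" using a by auto
qed

text \<open>First use of transfer: every pair in the restriction consists of some \<open>x\<close>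
  in \<open>A\<close> and \<open>star x\<close>, so at stage 0 the claim is transfer of
  \<open>\<sigma>\<close>.\<close>

lemma pairs_formula_star_restrict:
  assumes "fv \<sigma> \<subseteq> {1..k}" "A \<in> universe X E" "n \<le> k"
    and "e 0 = star_restrict X E star A"
    and "\<And>i. i \<in> {n<..k} \<Longrightarrow> E (e (2 * i + 8)) A \<and> e (2 * i + 9) = star (e (2 * i + 8))"
  shows "sat E (pairs_formula \<sigma> n) e"
  using assms(3-)
proof (induction n arbitrary: e)
  case 0
  have "{0<..k} = {1..k}" by auto
  note e = 0(3)[unfolded this]
  have "sat E \<sigma> (\<lambda>i. e (2 * i + 8)) \<longleftrightarrow> sat E \<sigma> (\<lambda>i. star (e (2 * i + 8)))"
    using e assms(1,2) elem_universe by (intro transfer[of \<sigma> k]) blast+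
  also have "\<dots> \<longleftrightarrow> sat E \<sigma> (\<lambda>i. e (2 * i + 9))"
    using e assms(1) by (intro sat_cong) (metis subsetD)
  finally show ?case by (simp only: sat_pairs_formula_0)
next
  case (Suc n)
  show ?case
    unfolding sat_pairs_formula_Suc
  proof (intro allI impI)
    fix p v x y
    assume "E p (e 0)" "is_pair E p x y"
    then have xy: "E x A" "y = star x"
      using star_restrict_pair[OF assms(2)] Suc.prems(2) by auto
    define e' where "e' = e(4 := p, 2 := v, 2 * Suc n + 8 := x, 2 * Suc n + 9 := y)"
    have "sat E (pairs_formula \<sigma> n) e'"
    proof (rule Suc.IH)
      show "n \<le> k" using Suc.prems(1) by simp
      show "e' 0 = star_restrict X E star A" using Suc.prems(2) by (simp add: e'_def)
      fix i assume i: "i \<in> {n<..k}"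
      show "E (e' (2 * i + 8)) A \<and> e' (2 * i + 9) = star (e' (2 * i + 8))"
      proof (cases "i = Suc n")
        case True
        then show ?thesis using xy by (simp add: e'_def)
      next
        case False
        then have "i \<in> {Suc n<..k}" using i by auto
        \<comment> \<open>Parity keeps the two families of variables apart.\<close>
        moreover have "2 * i + 8 \<noteq> 2 * Suc n + 9" "2 * i + 9 \<noteq> 2 * Suc n + 8" by presburger+
        then have "e' (2 * i + 8) = e (2 * i + 8)" "e' (2 * i + 9) = e (2 * i + 9)"
          using False by (auto simp: e'_def)
        ultimately show ?thesis using Suc.prems(3) by simp
      qed
    qed
    then show "sat E (pairs_formula \<sigma> n)
        (e(4 := p, 2 := v, 2 * Suc n + 8 := x, 2 * Suc n + 9 := y))"
      unfolding e'_def .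
  qed
qed

text \<open>Restricting to levels replaces the union over all \<open>A\<close> by an increasing
  chain.\<close>

definition star_graph :: "nat \<Rightarrow> 'v \<Rightarrow> 'v \<Rightarrow> bool" where
  "star_graph m \<xi> \<eta> \<longleftrightarrow>
    (\<exists>p. E p (star (star_restrict X E star (coll X E (level X E m)))) \<and> is_pair E p \<xi> \<eta>)"

lemma star_graph_sat:
  assumes "fv \<sigma> \<subseteq> {1..k}" "\<And>i. i \<in> {1..k} \<Longrightarrow> star_graph m (\<xi> i) (\<eta> i)"
  shows "sat E \<sigma> \<xi> \<longleftrightarrow> sat E \<sigma> \<eta>"
proof -
  let ?A = "coll X E (level X E m)"
  let ?F = "star_restrict X E star ?A"
  \<comment> \<open>At stage \<open>k\<close> no component has been assigned yet, so the constant
    valuation meets the hypothesis on components vacuously.\<close>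
  have F: "?F \<in> universe X E" "sat E (pairs_formula \<sigma> k) (\<lambda>i. ?F)"
    using star_restrict(1) universe_level_set pairs_formula_star_restrict[OF assms(1), of ?A k]
    by auto
  then have "sat E (pairs_formula \<sigma> k) (\<lambda>i. star ?F)"
    using transfer_fv[of "pairs_formula \<sigma> k" "\<lambda>i. ?F"] by simp
  \<comment> \<open>Inverts the numbering of the components; only variable 0 is free in the formula,
    so its truth value is unaffected.\<close>
  define e where "e j = (if j = 0 then star ?F
    else if even j then \<xi> ((j - 8) div 2) else \<eta> ((j - 9) div 2))" for j
  have e: "e (2 * i + 8) = \<xi> i" "e (2 * i + 9) = \<eta> i" "e 0 = star ?F" for i
    by (auto simp: e_def)
  have "fv (pairs_formula \<sigma> k) \<subseteq> {0}"
    using fv_pairs_formula[OF assms(1), of k] by simp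
  then have "sat E (pairs_formula \<sigma> k) e \<longleftrightarrow> sat E (pairs_formula \<sigma> k) (\<lambda>i. star ?F)"
    by (intro sat_cong) (auto simp: e_def)
  then have "sat E (pairs_formula \<sigma> k) e"
    using \<open>sat E (pairs_formula \<sigma> k) (\<lambda>i. star ?F)\<close> by simp
  from pairs_formula_elim[OF this] show ?thesis
    using assms(2) unfolding e star_graph_def by simp
qed

section \<open>Coherence of the graphs over different levels\<close>

lemma star_graph_mono:
  assumes "star_graph m \<xi> \<eta>" "m \<le> n"
  shows "star_graph n \<xi> \<eta>"
proof -
  have "elems E (star_restrict X E star (coll X E (level X E m)))
    \<subseteq> elems E (star_restrict X E star (coll X E (level X E n)))"
    using star_restrict(2) universe_level_set level_mono[OF assms(2)] by auto
  then show ?thesis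
    using star_mono star_restrict(1) universe_level_set(1) assms(1)
    unfolding star_graph_def elems_def by blast
qed

lemma star_graph_functional:
  assumes "star_graph m \<xi> \<eta>" "star_graph n \<xi> \<eta>'"
  shows "\<eta> = \<eta>'"
proof -
  have "star_graph (max m n) \<xi> \<eta>" "star_graph (max m n) \<xi> \<eta>'"
    using assms star_graph_mono by auto
  \<comment> \<open>For \<open>Eq 1 2\<close> the left side compares \<open>\<xi>\<close> with
    itself, so the right side yields \<open>\<eta> = \<eta>'\<close>.\<close>
  then show ?thesis
    using star_graph_sat[of "Eq 1 2" 2 "max m n" "\<lambda>i. \<xi>" "\<lambda>i. if i = 1 then \<eta> else \<eta>'"] by auto
qed

lemma obtain_level_superset:
  assumes "A \<in> universe X E"
  obtains m where "elems E A \<subseteq> elems E (coll X E (level X E m))"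
  using assms elems_subset_level universe_level_set(2) unfolding universe_def by blast

text \<open>By transfer of the statement that every element of the level is the first component of a
  pair in the restriction.\<close>

lemma star_graph_total:
  assumes "\<xi> \<in> internal X E star"
  shows "\<exists>m \<eta>. star_graph m \<xi> \<eta>"
proof -
  obtain A where A: "A \<in> universe X E" "\<xi> \<in> elems E (star A)"
    using assms unfolding internal_def by blast
  obtain m where m: "elems E A \<subseteq> elems E (coll X E (level X E m))"
    using obtain_level_superset[OF A(1)] .
  let ?A = "coll X E (level X E m)"
  let ?F = "star_restrict X E star ?A"
  \<comment> \<open>Variable 5 is the domain and 0 the restriction; 6 and 7 avoid the variables
    bound in \<open>pair_formula\<close>.\<close>
  let ?\<phi> = "BAll 6 5 (BEx 4 0 (BEx 2 4 (BEx 7 2 (pair_formula 4 6 7))))"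
  have sat: "sat E ?\<phi> e \<longleftrightarrow>
    (\<forall>x. E x (e 5) \<longrightarrow> (\<exists>p. E p (e 0) \<and> (\<exists>v. E v p \<and> (\<exists>y. E y v \<and> is_pair E p x y))))" for e
    by (simp add: sat_pair_formula)
  have "E \<xi> (star ?A)"
    using star_mono[OF A(1) universe_level_set(1) m] A(2) unfolding elems_def by blast
  moreover have "sat E ?\<phi> (\<lambda>i. if i = 5 then ?A else ?F)"
    unfolding sat
  proof (intro allI impI)
    fix x assume "E x (if (5::nat) = 5 then ?A else ?F)"
    then have x: "E x ?A" by simp
    then have "x \<in> universe X E" "star x \<in> universe X E"
      using elem_universe universe_level_set(1) star_universe by blast+
    then have pair: "is_pair E (opair X E x (star x)) x (star x)"
      by (rule is_pair_opair)
    have "opair X E x (star x) \<in> elems E ?F"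
      unfolding star_restrict(2)[OF universe_level_set(1)] using x unfolding elems_def by blast
    then show "\<exists>p. E p (if (0::nat) = 5 then ?A else ?F) \<and> (\<exists>v. E v p \<and> (\<exists>y. E y v \<and> is_pair E p x y))"
      using pair is_pair_imp_elem[OF pair] by (auto simp: elems_def)
  qed
  then have "sat E ?\<phi> (\<lambda>i. star (if i = 5 then ?A else ?F))"
    using transfer_fv[of ?\<phi> "\<lambda>i. if i = 5 then ?A else ?F"]
      universe_level_set(1) star_restrict(1) by auto
  then have "\<forall>x. E x (star ?A) \<longrightarrow> (\<exists>p. E p (star ?F) \<and> (\<exists>v. E v p \<and> (\<exists>y. E y v \<and> is_pair E p x y)))"
    unfolding sat by simp
  ultimately obtain p \<eta> where "E p (star ?F)" "is_pair E p \<xi> \<eta>"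
    by metis
  then show ?thesis
    unfolding star_graph_def by metis
qed

text \<open>Any \<open>A\<close> can be enlarged to a level by \<open>star_mono\<close>; conversely
  \<open>p\<close>, as an element of a star, lies in the universe and so equals
  \<open>opair X E \<xi> \<eta>\<close>.\<close>

lemma istar_graph_iff: "(\<xi>, \<eta>) \<in> istar_graph X E star \<longleftrightarrow> (\<exists>m. star_graph m \<xi> \<eta>)"
proof
  assume "(\<xi>, \<eta>) \<in> istar_graph X E star"
  then obtain A where A: "A \<in> universe X E" "\<xi> \<in> universe X E" "\<eta> \<in> universe X E"
    "opair X E \<xi> \<eta> \<in> elems E (star (star_restrict X E star A))"
    unfolding istar_graph_def by blast
  obtain m where m: "elems E A \<subseteq> elems E (coll X E (level X E m))"
    using obtain_level_superset[OF A(1)] .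
  have "elems E (star_restrict X E star A) \<subseteq> elems E (star_restrict X E star (coll X E (level X E m)))"
    using m star_restrict(2) universe_level_set(1) A(1) by auto
  then have "opair X E \<xi> \<eta> \<in> elems E (star (star_restrict X E star (coll X E (level X E m))))"
    using star_mono star_restrict(1) universe_level_set(1) A by blast
  then show "\<exists>m. star_graph m \<xi> \<eta>"
    using is_pair_opair[OF A(2,3)] unfolding star_graph_def elems_def by blast
next
  assume "\<exists>m. star_graph m \<xi> \<eta>"
  then obtain m p where p: "E p (star (star_restrict X E star (coll X E (level X E m))))"
    "is_pair E p \<xi> \<eta>"
    unfolding star_graph_def by blast
  then have "p \<in> universe X E"
    using elem_universe star_universe star_restrict(1) universe_level_set(1) by blast
  with p show "(\<xi>, \<eta>) \<in> istar_graph X E star"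
    using is_pair_universe[of p \<xi> \<eta>] universe_level_set(1)
    unfolding istar_graph_def elems_def by blast
qed

section \<open>From the graphs to \<open>istar\<close> and its transfer\<close>

lemma star_graph_istar:
  assumes "\<xi> \<in> internal X E star"
  shows "\<exists>m. star_graph m \<xi> (istar X E star \<xi>)"
proof -
  obtain m \<eta> where \<eta>: "star_graph m \<xi> \<eta>"
    using star_graph_total[OF assms] by auto
  have "istar X E star \<xi> = \<eta>"
    unfolding istar_def istar_graph_iff
  proof (rule the_equality)
    show "\<exists>m. star_graph m \<xi> \<eta>" using \<eta> by (rule exI)
    show "\<eta>' = \<eta>" if "\<exists>m. star_graph m \<xi> \<eta>'" for \<eta>'
      using that star_graph_functional[OF _ \<eta>] by (elim exE)
  qed
  with \<eta> show ?thesis by auto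
qed

lemma istar_sat:
  assumes "fv \<sigma> \<subseteq> {1..k}" "\<forall>i\<in>{1..k}. \<xi> i \<in> internal X E star"
  shows "sat E \<sigma> \<xi> \<longleftrightarrow> sat E \<sigma> (\<lambda>i. istar X E star (\<xi> i))"
proof -
  \<comment> \<open>\<open>LEAST\<close> chooses a level for each argument; the maximum of these
    finitely many levels serves all arguments by monotonicity.\<close>
  define m where "m i = (LEAST m. star_graph m (\<xi> i) (istar X E star (\<xi> i)))" for i
  have m: "star_graph (m i) (\<xi> i) (istar X E star (\<xi> i))" if "i \<in> {1..k}" for i
    unfolding m_def by (rule LeastI_ex, rule star_graph_istar, rule bspec[OF assms(2) that])
  show ?thesis
  proof (rule star_graph_sat[OF assms(1)])
    fix i assume i: "i \<in> {1..k}"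
    then have "m i \<le> Max (m ` {1..k})" by simp
    with m[OF i] show "star_graph (Max (m ` {1..k})) (\<xi> i) (istar X E star (\<xi> i))"
      by (rule star_graph_mono)
  qed
qed

end

theorem theorem2p5:
  fixes X :: "'v set"
    and E :: "'v \<Rightarrow> 'v \<Rightarrow> bool"
    and rl :: "real \<Rightarrow> 'v"
    and star :: "'v \<Rightarrow> 'v"
    and \<sigma> :: bformula
    and k :: nat
    and \<xi> :: "nat \<Rightarrow> 'v"
  assumes "star_map X E rl star"
    and "fv \<sigma> \<subseteq> {1..k}"
    and "\<forall>i\<in>{1..k}. \<xi> i \<in> internal X E star"
  shows "sat E \<sigma> \<xi> \<longleftrightarrow> sat E \<sigma> (\<lambda>i. istar X E star (\<xi> i))"
  using star_map.istar_sat[OF assms] .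

end
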